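(* Let $a,b,c,d,e$ be complex parameters with $\Re(e-d)>0$ and $\Re(d+e-a-b-c)>0$. Then $$F_{1:1}^{0:3}\left[{-\atop d}:{a,b,c\atop e};{d-a,d-b,d-c\atop d+e-a-b-c};1,1\right]=\frac{\Gamma(e)\,\Gamma(e+d-a-b-c)\,\Gamma(e-d)}{\Gamma(e-a)\,\Gamma(e-b)\,\Gamma(e-c)}.$$
   Context: $(x)_m=x(x+1)\cdots(x+m-1)$, $(x)_0=1$, is the Pochhammer symbol, and $(x_1,\dots,x_r)_m=(x_1)_m\cdots(x_r)_m$. The Kampé de Fériet series is $$F_{1:1}^{0:3}\left[{-\atop d}:{a,b,c\atop e};{a',b',c'\atop e'};x,y\right]=\sum_{m,n=0}^\infty\frac{(a,b,c)_m(a',b',c')_n}{(d)_{m+n}(e)_m(e')_n}\frac{x^my^n}{m!\,n!}.$$ It is absolutely convergent for $|x|=|y|=1$ when $\Re(d+e-a-b-c)>0$ and $\Re(d+e'-a'-b'-c')>0$. It is understood that no denominator parameter of the series ($d$, $e$, $e'$) is zero or a negative integer; $1/\Gamma$ is taken to be $0$ at zero and the negative integers. *)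

theory Defs
  imports "HOL-Analysis.Analysis"
begin

definition kampe_term ::
  "complex \<Rightarrow> complex \<Rightarrow> complex \<Rightarrow> complex \<Rightarrow> complex \<Rightarrow>
   complex \<Rightarrow> complex \<Rightarrow> complex \<Rightarrow> complex \<Rightarrow> complex \<Rightarrow> complex \<Rightarrow> nat \<times> nat \<Rightarrow> complex" where
  "kampe_term d a b c e a' b' c' e' x y = (\<lambda>(m, n).
     (pochhammer a m * pochhammer b m * pochhammer c m) *
     (pochhammer a' n * pochhammer b' n * pochhammer c' n) /
     (pochhammer d (m + n) * pochhammer e m * pochhammer e' n) *
     (x ^ m * y ^ n / (fact m * fact n)))"

text \<open>
  The series \<open>F\<^sub>1\<^sub>:\<^sub>1\<^sup>0\<^sup>:\<^sup>3[- / d : a,b,c / e ; a',b',c' / e' ; x, y]\<close>. The double sum is unordered;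
  \<^const>\<open>infsum\<close> is \<open>0\<close> by convention when the terms are not summable, and division by zero yields
  \<open>0\<close>, so statements about it need summability and
  \<open>d, e, e' \<notin> \<int>\<^sub>\<le>\<^sub>0\<close>.
\<close>

definition kampe_F ::
  "complex \<Rightarrow> complex \<Rightarrow> complex \<Rightarrow> complex \<Rightarrow> complex \<Rightarrow>
   complex \<Rightarrow> complex \<Rightarrow> complex \<Rightarrow> complex \<Rightarrow> complex \<Rightarrow> complex \<Rightarrow> complex" where
  "kampe_F d a b c e a' b' c' e' x y =
     (\<Sum>\<^sub>\<infinity>p\<in>UNIV. kampe_term d a b c e a' b' c' e' x y p)"

end

theory Submission
  imports Defs "HOL-Real_Asymp.Real_Asymp"
begin

text \<open>
  Fix \<open>a, b, c, d\<close>, put \<open>s = d + e - a - b - c\<close>, and let \<open>S(e)\<close> be the double sum with terms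
  \<open>t\<^sub>e(m, n)\<close>. Replacing \<open>e\<close> by \<open>e + 1\<close> also replaces \<open>s\<close> by \<open>s + 1\<close>, and the claimed Gamma
  quotient then changes by a rational factor. As in the classical proof of Gauss's theorem, it
  suffices to show that \<open>S\<close> obeys the same recurrence
  \[ e (e - d) s S(e) = (e - a) (e - b) (e - c) S(e + 1) \]
  and that \<open>S(e + N)\<close> tends to \<open>1\<close>: iterating the recurrence expresses \<open>S(e)\<close> by a quotient of
  Pochhammer symbols of length \<open>N\<close>, which converges to the Gamma quotient by Euler's limit
  formula.

  The recurrence comes from creative telescoping in two variables. With
  \<open>G(m, n) = (d - e + n) / (s + n) m t\<^sub>e(m, n)\<close> and \<open>H(m, n) = - n t\<^sub>e(m, n)\<close>,
  \[ (e - d) t_e(m, n) - \frac{(e - a) (e - b) (e - c)}{e s} t_{e + 1}(m, n)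
      = (G(m + 1, n) - G(m, n)) + (H(m, n + 1) - H(m, n)), \]
  a rational identity once the common factor is removed (\<open>dual_term_certificate\<close>). Summed over
  the square \<open>m, n < N\<close> only the two far edges remain. They vanish in the limit because of
  \<open>norm_dual_term_le\<close>, which bounds the terms by a multiple of
  \<open>(m + 1) powr (-1 - Re s) (n + 1) powr (-1 - Re (e - d))\<close>; the same bound gives absolute
  convergence. The two positivity conditions are what makes this bound summable.
\<close>

section \<open>Growth of Pochhammer symbols\<close>

lemma Re_pos_notin_nonpos_Ints: "Re z > 0 \<Longrightarrow> z \<notin> \<int>\<^sub>\<le>\<^sub>0"
  by (auto elim!: nonpos_Ints_cases)

lemma add_of_nat_notin_nonpos_Ints:
  fixes z :: complex
  assumes "z \<notin> \<int>\<^sub>\<le>\<^sub>0"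
  shows "z + of_nat n \<notin> \<int>\<^sub>\<le>\<^sub>0"
proof
  assume "z + of_nat n \<in> \<int>\<^sub>\<le>\<^sub>0"
  then obtain k where "z + of_nat n = - of_nat k"
    by (elim nonpos_Ints_cases')
  hence "z = - of_nat (k + n)"
    by (simp add: eq_diff_eq [symmetric])
  hence "z \<in> \<int>\<^sub>\<le>\<^sub>0"
    by (simp only: minus_of_nat_in_nonpos_Ints)
  with assms show False by contradiction
qed

lemma add_of_nat_neq_0:
  fixes z :: complex
  assumes "z \<notin> \<int>\<^sub>\<le>\<^sub>0"
  shows "z + of_nat n \<noteq> 0"
  using add_of_nat_notin_nonpos_Ints[OF assms, of n] by auto

lemma pochhammer_neq_0:
  fixes z :: complex
  assumes "z \<notin> \<int>\<^sub>\<le>\<^sub>0"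
  shows "pochhammer z n \<noteq> 0"
  using assms by (auto simp: pochhammer_eq_0_iff)

text \<open>
  This is Euler's limit formula for \<open>1/\<Gamma>\<close>, read as an asymptotic law. The base \<open>n + 1\<close> instead of
  \<open>n\<close> keeps the comparison sequence nonzero at every index, so that convergence yields bounds
  valid for all \<open>n\<close>.
\<close>

lemma pochhammer_growth_LIMSEQ:
  fixes z :: complex
  shows "(\<lambda>n. norm (pochhammer z n) / (fact n * real (n + 1) powr (Re z - 1)))
           \<longlonglongrightarrow> norm (rGamma z)"
proof -
  have "(\<lambda>n. norm (rGamma_series z n) *
             (real n powr Re z / (real (n + 1) * real (n + 2) powr (Re z - 1))))
          \<longlonglongrightarrow> norm (rGamma z) * 1"
    by (intro tendsto_mult tendsto_norm rGamma_series_LIMSEQ) real_asymp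
  moreover have "\<forall>\<^sub>F n in sequentially.
      norm (rGamma_series z n) *
        (real n powr Re z / (real (n + 1) * real (n + 2) powr (Re z - 1))) =
      norm (pochhammer z (Suc n)) / (fact (Suc n) * real (Suc n + 1) powr (Re z - 1))"
    using eventually_gt_at_top[of 0]
    by eventually_elim
       (simp add: rGamma_series_def norm_divide norm_mult powr_def field_simps)
  ultimately have "(\<lambda>n. norm (pochhammer z (Suc n)) /
                      (fact (Suc n) * real (Suc n + 1) powr (Re z - 1)))
                     \<longlonglongrightarrow> norm (rGamma z)"
    by (simp add: filterlim_cong)
  thus ?thesis
    by (rule LIMSEQ_imp_Suc)
qed

lemma norm_pochhammer_le:
  fixes z :: complex
  obtains C where "C > 0"
    and "\<And>n. norm (pochhammer z n) \<le> C * (fact n * real (n + 1) powr (Re z - 1))"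
proof -
  obtain C where C: "C > 0"
    "\<And>n. norm (norm (pochhammer z n) / (fact n * real (n + 1) powr (Re z - 1))) \<le> C"
    using BseqE[OF convergent_imp_Bseq[OF convergentI[OF pochhammer_growth_LIMSEQ[of z]]]]
    by metis
  have "norm (pochhammer z n) \<le> C * (fact n * real (n + 1) powr (Re z - 1))" for n
    using C(2)[of n] by (simp add: divide_le_eq)
  with C(1) show ?thesis by (rule that)
qed

text \<open>
  Off the poles of \<open>\<Gamma>\<close> the limit above is nonzero, and so is every member of the sequence; hence
  the reciprocals converge and are bounded as well.
\<close>

lemma norm_inverse_pochhammer_le:
  fixes z :: complex
  assumes "z \<notin> \<int>\<^sub>\<le>\<^sub>0"
  obtains C where "C > 0"
    and "\<And>n. inverse (norm (pochhammer z n)) \<le>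
               C * inverse (fact n * real (n + 1) powr (Re z - 1))"
proof -
  have nz: "pochhammer z n \<noteq> 0" for n
    using assms by (rule pochhammer_neq_0)
  have "(\<lambda>n. inverse (norm (pochhammer z n) / (fact n * real (n + 1) powr (Re z - 1))))
          \<longlonglongrightarrow> inverse (norm (rGamma z))"
    using assms by (intro tendsto_inverse pochhammer_growth_LIMSEQ) (auto simp: rGamma_eq_zero_iff)
  from BseqE[OF convergent_imp_Bseq[OF convergentI[OF this]]]
  obtain C where C: "C > 0"
    "\<And>n. norm (inverse (norm (pochhammer z n) / (fact n * real (n + 1) powr (Re z - 1)))) \<le> C"
    by metis
  have "inverse (norm (pochhammer z n)) \<le> C * inverse (fact n * real (n + 1) powr (Re z - 1))"
    for n using C(2)[of n] nz[of n] by (simp add: field_simps)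
  with C(1) show ?thesis by (rule that)
qed

text \<open>
  Write \<open>x = m + 1\<close>, \<open>y = n + 1\<close> and \<open>k = min m n\<close>. The quotient \<open>x y / (x + y - 1)\<close> lies
  between \<open>1\<close> and \<open>k + 1\<close>, so any fixed power of it grows at most polynomially in \<open>k\<close>,
  while \<open>m + n\<close> choose \<open>m\<close> is at least \<open>2 ^ k\<close>.
\<close>

lemma inverse_binomial_mult_powr_bounded:
  fixes r :: real
  obtains C where "C > 0"
    and "\<And>m n. fact m * fact n / fact (m + n) *
                 (real (m + 1) * real (n + 1) / real (m + n + 1)) powr r \<le> C"
proof -
  define r' where "r' = max r 0"
  have "(\<lambda>k. real (k + 1) powr r' / 2 ^ k) \<longlonglongrightarrow> 0"
    by real_asymp
  from BseqE[OF convergent_imp_Bseq[OF convergentI[OF this]]]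
  obtain C where C: "C > 0" "\<And>k. norm (real (k + 1) powr r' / 2 ^ k) \<le> C"
    by metis
  have "fact m * fact n / fact (m + n) *
          (real (m + 1) * real (n + 1) / real (m + n + 1)) powr r \<le> C" for m n
  proof -
    define k where "k = min m n"
    define q where "q = real (m + 1) * real (n + 1) / real (m + n + 1)"
    have q1: "1 \<le> q"
      by (simp add: q_def field_simps)
    have qk: "q \<le> real (k + 1)"
    proof -
      have "q \<le> real (m + 1)" "q \<le> real (n + 1)"
        by (simp_all add: q_def divide_simps algebra_simps)
      thus ?thesis by (simp add: k_def min_def)
    qed
    have "(2::real) ^ k \<le> (real (m + n) / real k) ^ k"
    proof (cases "k = 0")
      case False
      hence "2 * real k \<le> real (m + n)" by (simp add: k_def)
      with False show ?thesis
        by (intro power_mono) (simp_all add: le_divide_eq)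
    qed simp
    also have "\<dots> \<le> real ((m + n) choose k)"
      by (rule binomial_ge_n_over_k_pow_k) (simp add: k_def)
    also have "(m + n) choose k = (m + n) choose m"
      using binomial_symmetric[of m "m + n"] by (simp add: k_def min_def)
    also have "real ((m + n) choose m) = fact (m + n) / (fact m * fact n)"
      by (simp add: binomial_fact)
    finally have two: "fact m * fact n / fact (m + n) \<le> 1 / (2::real) ^ k"
      by (simp add: field_simps)
    have "q powr r \<le> q powr r'"
      using q1 by (intro powr_mono) (auto simp: r'_def)
    also have "\<dots> \<le> real (k + 1) powr r'"
      using q1 qk by (intro powr_mono2) (auto simp: r'_def)
    finally have "fact m * fact n / fact (m + n) * q powr r \<le> 1 / 2 ^ k * real (k + 1) powr r'"
      using two by (intro mult_mono) auto
    also have "\<dots> \<le> C"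
      using C(2)[of k] by simp
    finally show ?thesis by (simp add: q_def)
  qed
  with C(1) show ?thesis by (rule that)
qed


section \<open>The terms of the series\<close>

text \<open>
  The parameters of the second factor are determined by those of the first, so the five
  parameters \<open>a, b, c, d, e\<close> suffice.
\<close>

definition dual_term ::
  "complex \<Rightarrow> complex \<Rightarrow> complex \<Rightarrow> complex \<Rightarrow> complex \<Rightarrow> nat \<times> nat \<Rightarrow> complex" where
  "dual_term a b c d e =
     kampe_term d a b c e (d - a) (d - b) (d - c) (d + e - a - b - c) 1 1"

lemma dual_term_eq:
  "dual_term a b c d e (m, n) =
     (pochhammer a m * pochhammer b m * pochhammer c m) *
     (pochhammer (d - a) n * pochhammer (d - b) n * pochhammer (d - c) n) /
     (pochhammer d (m + n) * pochhammer e m * pochhammer (d + e - a - b - c) n *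
      (fact m * fact n))"
  by (simp add: dual_term_def kampe_term_def)

text \<open>
  After Stirling-type estimates for the nine Pochhammer symbols, the exponents of \<open>m + 1\<close> and
  \<open>n + 1\<close> add up to \<open>Re d - 2 - Re s\<close> and \<open>Re d - 2 - Re (e - d)\<close> where
  \<open>s = d + e - a - b - c\<close>; the excess \<open>Re d - 1\<close> is absorbed by \<open>1 / (d)\<^sub>m\<^sub>+\<^sub>n\<close> together with
  the reciprocal binomial coefficient.
\<close>

lemma norm_dual_term_le:
  fixes a b c d e :: complex
  defines "s \<equiv> d + e - a - b - c"
  assumes d: "d \<notin> \<int>\<^sub>\<le>\<^sub>0" and e: "e \<notin> \<int>\<^sub>\<le>\<^sub>0" and s: "s \<notin> \<int>\<^sub>\<le>\<^sub>0"
  obtains C where "C > 0"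
    and "\<And>m n. norm (dual_term a b c d e (m, n)) \<le>
           C * (real (m + 1) powr (-1 - Re s) * real (n + 1) powr (-1 - Re (e - d)))"
proof -
  obtain Ca where Ca: "Ca > 0"
    "\<And>n. norm (pochhammer a n) \<le> Ca * (fact n * real (n + 1) powr (Re a - 1))"
    using norm_pochhammer_le[of a] by metis
  obtain Cb where Cb: "Cb > 0"
    "\<And>n. norm (pochhammer b n) \<le> Cb * (fact n * real (n + 1) powr (Re b - 1))"
    using norm_pochhammer_le[of b] by metis
  obtain Cc where Cc: "Cc > 0"
    "\<And>n. norm (pochhammer c n) \<le> Cc * (fact n * real (n + 1) powr (Re c - 1))"
    using norm_pochhammer_le[of c] by metis
  obtain Da where Da: "Da > 0"
    "\<And>n. norm (pochhammer (d - a) n) \<le> Da * (fact n * real (n + 1) powr (Re (d - a) - 1))"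
    using norm_pochhammer_le[of "d - a"] by metis
  obtain Db where Db: "Db > 0"
    "\<And>n. norm (pochhammer (d - b) n) \<le> Db * (fact n * real (n + 1) powr (Re (d - b) - 1))"
    using norm_pochhammer_le[of "d - b"] by metis
  obtain Dc where Dc: "Dc > 0"
    "\<And>n. norm (pochhammer (d - c) n) \<le> Dc * (fact n * real (n + 1) powr (Re (d - c) - 1))"
    using norm_pochhammer_le[of "d - c"] by metis
  obtain Kd where Kd: "Kd > 0"
    "\<And>n. inverse (norm (pochhammer d n)) \<le> Kd * inverse (fact n * real (n + 1) powr (Re d - 1))"
    using norm_inverse_pochhammer_le[OF d] by metis
  obtain Ke where Ke: "Ke > 0"
    "\<And>n. inverse (norm (pochhammer e n)) \<le> Ke * inverse (fact n * real (n + 1) powr (Re e - 1))"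
    using norm_inverse_pochhammer_le[OF e] by metis
  obtain Ks where Ks: "Ks > 0"
    "\<And>n. inverse (norm (pochhammer s n)) \<le> Ks * inverse (fact n * real (n + 1) powr (Re s - 1))"
    using norm_inverse_pochhammer_le[OF s] by metis
  obtain B where B: "B > 0"
    "\<And>m n. fact m * fact n / fact (m + n) *
        (real (m + 1) * real (n + 1) / real (m + n + 1)) powr (Re d - 1) \<le> B"
    using inverse_binomial_mult_powr_bounded[of "Re d - 1"] by metis
  define K where "K = (Ca * Cb * Cc) * (Da * Db * Dc) * (Kd * Ke * Ks)"
  have K: "K > 0" using Ca Cb Cc Da Db Dc Kd Ke Ks by (simp add: K_def)
  have "norm (dual_term a b c d e (m, n)) \<le>
          K * B * (real (m + 1) powr (-1 - Re s) * real (n + 1) powr (-1 - Re (e - d)))" for m n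
  proof -
    define x y w where "x = real (m + 1)" and "y = real (n + 1)" and "w = real (m + n + 1)"
    have pos: "x > 0" "y > 0" "w > 0" by (simp_all add: x_def y_def w_def)
    have "norm (dual_term a b c d e (m, n)) =
        (norm (pochhammer a m) * norm (pochhammer b m) * norm (pochhammer c m)) *
        (norm (pochhammer (d - a) n) * norm (pochhammer (d - b) n) * norm (pochhammer (d - c) n)) *
        (inverse (norm (pochhammer d (m + n))) * inverse (norm (pochhammer e m)) *
         inverse (norm (pochhammer s n))) * inverse (fact m * fact n)"
      by (simp add: dual_term_eq s_def norm_mult norm_inverse divide_inverse mult_ac)
    also have "\<dots> \<le>
        ((Ca * (fact m * x powr (Re a - 1))) * (Cb * (fact m * x powr (Re b - 1))) *
         (Cc * (fact m * x powr (Re c - 1)))) *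
        ((Da * (fact n * y powr (Re (d - a) - 1))) * (Db * (fact n * y powr (Re (d - b) - 1))) *
         (Dc * (fact n * y powr (Re (d - c) - 1)))) *
        ((Kd * inverse (fact (m + n) * w powr (Re d - 1))) *
         (Ke * inverse (fact m * x powr (Re e - 1))) *
         (Ks * inverse (fact n * y powr (Re s - 1)))) * inverse (fact m * fact n)"
      unfolding x_def y_def w_def using Ca(1) Cb(1) Cc(1) Da(1) Db(1) Dc(1) Kd(1) Ke(1) Ks(1)
      by (intro mult_mono Ca(2) Cb(2) Cc(2) Da(2) Db(2) Dc(2) Kd(2) Ke(2) Ks(2)
            mult_nonneg_nonneg) (simp_all add: less_imp_le)
    also have "\<dots> = K * (fact m * fact n / fact (m + n)) *
        ((x powr (Re a - 1) * x powr (Re b - 1) * x powr (Re c - 1) / x powr (Re e - 1)) *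
         (y powr (Re (d - a) - 1) * y powr (Re (d - b) - 1) * y powr (Re (d - c) - 1) /
            y powr (Re s - 1)) / w powr (Re d - 1))"
      by (simp add: K_def field_simps)
    also have "x powr (Re a - 1) * x powr (Re b - 1) * x powr (Re c - 1) / x powr (Re e - 1) =
        x powr (Re d - 1) * x powr (-1 - Re s)"
      by (simp add: powr_add[symmetric] powr_diff[symmetric] s_def algebra_simps)
    also have "y powr (Re (d - a) - 1) * y powr (Re (d - b) - 1) * y powr (Re (d - c) - 1) /
            y powr (Re s - 1) = y powr (Re d - 1) * y powr (-1 - Re (e - d))"
      by (simp add: powr_add[symmetric] powr_diff[symmetric] s_def algebra_simps)
    also have "K * (fact m * fact n / fact (m + n)) *
        ((x powr (Re d - 1) * x powr (-1 - Re s)) * (y powr (Re d - 1) * y powr (-1 - Re (e - d))) /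
          w powr (Re d - 1)) =
        K * (fact m * fact n / fact (m + n) * (x * y / w) powr (Re d - 1)) *
        (x powr (-1 - Re s) * y powr (-1 - Re (e - d)))"
      using pos by (simp add: powr_mult powr_divide)
    also have "\<dots> \<le> K * B * (x powr (-1 - Re s) * y powr (-1 - Re (e - d)))"
      using B(2)[of m n] K by (intro mult_right_mono mult_left_mono) (simp_all add: x_def y_def w_def)
    finally show ?thesis by (simp add: x_def y_def)
  qed
  moreover have "K * B > 0" using K B by simp
  ultimately show ?thesis by (metis that)
qed

lemma summable_Suc_powr:
  fixes r :: real
  assumes "r > 0"
  shows "summable (\<lambda>n. real (n + 1) powr (-1 - r))"
proof -
  have "summable (\<lambda>n. real n powr (-1 - r))"
    using assms by (subst summable_real_powr_iff) auto
  thus ?thesis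
    by (subst (asm) summable_Suc_iff[symmetric]) (simp add: add.commute)
qed

lemma dual_term_abs_summable:
  fixes a b c d e :: complex
  assumes "d \<notin> \<int>\<^sub>\<le>\<^sub>0" "e \<notin> \<int>\<^sub>\<le>\<^sub>0" "Re (d + e - a - b - c) > 0" "Re (e - d) > 0"
  shows "(\<lambda>p. norm (dual_term a b c d e p)) summable_on UNIV"
proof -
  define s where "s = d + e - a - b - c"
  have s: "s \<notin> \<int>\<^sub>\<le>\<^sub>0" "Re s > 0"
    using assms(3) Re_pos_notin_nonpos_Ints by (auto simp: s_def)
  obtain C where C: "C > 0"
    "\<And>m n. norm (dual_term a b c d e (m, n)) \<le>
        C * (real (m + 1) powr (-1 - Re s) * real (n + 1) powr (-1 - Re (e - d)))"
    using norm_dual_term_le[of d e a b c] assms s unfolding s_def by metis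
  define f g where "f = (\<lambda>m. real (m + 1) powr (-1 - Re s))"
    and "g = (\<lambda>n. real (n + 1) powr (-1 - Re (e - d)))"
  have f: "f summable_on UNIV"
    unfolding f_def by (subst summable_on_UNIV_nonneg_real_iff) (use s summable_Suc_powr in auto)
  have g: "g summable_on UNIV"
    unfolding g_def by (subst summable_on_UNIV_nonneg_real_iff) (use assms summable_Suc_powr in auto)
  have "(\<lambda>(m, n). f m * g n) summable_on Sigma UNIV (\<lambda>_. UNIV)"
  proof (rule summable_on_SigmaI[where g = "\<lambda>m. f m * infsum g UNIV"])
    show "((\<lambda>n. case (m, n) of (m, n) \<Rightarrow> f m * g n) has_sum f m * infsum g UNIV) UNIV" for m
      using has_sum_cmult_right[OF has_sum_infsum[OF g], of "f m"] by simp
    show "(\<lambda>m. f m * infsum g UNIV) summable_on UNIV"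
      by (rule summable_on_cmult_left[OF f])
  qed (simp add: f_def g_def)
  hence "(\<lambda>(m, n). f m * g n) summable_on UNIV"
    by simp
  hence "(\<lambda>p. C * (case p of (m, n) \<Rightarrow> f m * g n)) summable_on UNIV"
    by (rule summable_on_cmult_right)
  thus ?thesis
    by (rule Infinite_Sum.abs_summable_on_comparison_test') (use C in \<open>auto simp: f_def g_def\<close>)
qed

section \<open>The recurrence in the parameter e\<close>

lemma dual_term_Suc_fst:
  "dual_term a b c d e (Suc m, n) =
     dual_term a b c d e (m, n) * ((a + of_nat m) * (b + of_nat m) * (c + of_nat m)) /
     ((d + of_nat m + of_nat n) * (e + of_nat m) * of_nat (Suc m))"
  by (simp add: dual_term_eq pochhammer_Suc add.assoc mult_ac del: of_nat_Suc)

lemma dual_term_Suc_snd: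
  "dual_term a b c d e (m, Suc n) =
     dual_term a b c d e (m, n) *
     ((d - a + of_nat n) * (d - b + of_nat n) * (d - c + of_nat n)) /
     ((d + of_nat m + of_nat n) * (d + e - a - b - c + of_nat n) * of_nat (Suc n))"
  by (simp add: dual_term_eq pochhammer_Suc add.assoc mult_ac del: of_nat_Suc)

lemma pochhammer_plus_1:
  fixes z :: complex
  assumes "z \<notin> \<int>\<^sub>\<le>\<^sub>0"
  shows "pochhammer (z + 1) n = pochhammer z n * (z + of_nat n) / z"
proof -
  have "z \<noteq> 0" using assms by auto
  thus ?thesis
    using pochhammer_rec[of z n] pochhammer_Suc[of z n] by (simp add: field_simps)
qed

lemma dual_term_plus_1:
  fixes a b c d e :: complex
  defines "s \<equiv> d + e - a - b - c"
  assumes "e \<notin> \<int>\<^sub>\<le>\<^sub>0" "s \<notin> \<int>\<^sub>\<le>\<^sub>0"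
  shows "dual_term a b c d (e + 1) (m, n) =
           dual_term a b c d e (m, n) * (e * s) / ((e + of_nat m) * (s + of_nat n))"
proof -
  have *: "d + (e + 1) - a - b - c = s + 1" by (simp add: s_def)
  show ?thesis
    unfolding dual_term_eq * unfolding s_def [symmetric]
    using assms(2,3) by (simp add: pochhammer_plus_1 mult_ac)
qed

text \<open>
  Dividing by \<open>u = t (m, n) / ((d + m + n) (e + m) (s + n))\<close> turns every term into a polynomial.
  The pair \<open>G\<close>, \<open>H\<close> is found by an ansatz whose multipliers of \<open>m t\<close> (relative to \<open>s + n\<close>) and
  \<open>n t\<close> (relative to \<open>e + m\<close>) are unknown linear polynomials, here \<open>d - e + n\<close> and
  \<open>- (e + m)\<close>. The factors \<open>m\<close> and \<open>n\<close> make \<open>G\<close> and \<open>H\<close> vanish on the coordinate axes. Modulo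
  \<open>d + m + n\<close> the two multipliers agree, while \<open>d - a + n\<close> agrees with \<open>- (a + m)\<close>, and
  likewise for \<open>b\<close> and \<open>c\<close>; hence the denominator \<open>d + m + n\<close> produced by the two forward
  shifts cancels in their sum.
\<close>

lemma dual_term_certificate:
  fixes a b c d e :: complex
  defines "s \<equiv> d + e - a - b - c"
  defines "t \<equiv> dual_term a b c d e"
  defines "G \<equiv> \<lambda>m n. (d - e + of_nat n) / (s + of_nat n) * of_nat m * t (m, n)"
  defines "H \<equiv> \<lambda>m n. - of_nat n * t (m, n)"
  assumes d: "d \<notin> \<int>\<^sub>\<le>\<^sub>0" and e: "e \<notin> \<int>\<^sub>\<le>\<^sub>0" and s: "s \<notin> \<int>\<^sub>\<le>\<^sub>0"
  shows "(e - d) * t (m, n) - (e - a) * (e - b) * (e - c) / (e * s) * dual_term a b c d (e + 1) (m, n)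
       = (G (Suc m) n - G m n) + (H m (Suc n) - H m n)"
proof -
  define M N :: complex where "M = of_nat m" and "N = of_nat n"
  define u where "u = t (m, n) / ((d + M + N) * (e + M) * (s + N))"
  have nz: "d + M + N \<noteq> 0" "e + M \<noteq> 0" "s + N \<noteq> 0" "e \<noteq> 0" "s \<noteq> 0"
    using add_of_nat_neq_0[OF d, of "m + n"] add_of_nat_neq_0[OF e]
      add_of_nat_neq_0[OF s] e s by (auto simp: M_def N_def add.assoc)
  have t: "t (m, n) = u * ((d + M + N) * (e + M) * (s + N))"
    using nz by (simp add: u_def)
  have shift: "dual_term a b c d (e + 1) (m, n) = u * (d + M + N) * (e * s)"
    using nz dual_term_plus_1[of e d a b c m n] e s t
    by (simp add: s_def t_def M_def N_def)
  have G1: "G (Suc m) n = u * ((d - e + N) * ((a + M) * (b + M) * (c + M)))"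
    using nz by (simp add: G_def t_def dual_term_Suc_fst u_def M_def N_def del: of_nat_Suc)
  have G0: "G m n = u * ((d - e + N) * M * ((d + M + N) * (e + M)))"
    using nz by (simp add: G_def t M_def N_def)
  have H1: "H m (Suc n) = - u * ((d - a + N) * (d - b + N) * (d - c + N) * (e + M))"
    using nz by (simp add: H_def t_def dual_term_Suc_snd u_def M_def N_def s_def del: of_nat_Suc)
  have H0: "H m n = - u * (N * ((d + M + N) * (e + M) * (s + N)))"
    by (simp add: H_def t M_def N_def)
  have "(e - d) * t (m, n) - (e - a) * (e - b) * (e - c) / (e * s) *
          dual_term a b c d (e + 1) (m, n) =
        u * (d + M + N) * ((e - d) * (e + M) * (s + N) - (e - a) * (e - b) * (e - c))"
  proof -
    have "(e - a) * (e - b) * (e - c) / (e * s) * (u * (d + M + N) * (e * s)) =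
          (e - a) * (e - b) * (e - c) * (u * (d + M + N))"
      using nz by simp
    thus ?thesis
      unfolding shift t by algebra
  qed
  also have "\<dots> = (G (Suc m) n - G m n) + (H m (Suc n) - H m n)"
    unfolding G1 G0 H1 H0 s_def by algebra
  finally show ?thesis .
qed

lemma sum_squares_LIMSEQ_infsum:
  fixes f :: "nat \<times> nat \<Rightarrow> 'a :: {comm_monoid_add, t2_space}"
  assumes "f summable_on UNIV"
  shows "(\<lambda>N. \<Sum>m<N. \<Sum>n<N. f (m, n)) \<longlonglongrightarrow> infsum f UNIV"
proof -
  have "filterlim (\<lambda>N. {..<N} \<times> {..<N}) (finite_subsets_at_top (UNIV :: (nat \<times> nat) set)) at_top"
    unfolding filterlim_finite_subsets_at_top
  proof (intro allI impI)
    fix X :: "(nat \<times> nat) set"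
    assume "finite X \<and> X \<subseteq> UNIV"
    hence fin: "finite (fst ` X \<union> snd ` X)" by simp
    have "\<forall>\<^sub>F N in at_top. \<forall>k\<in>fst ` X \<union> snd ` X. k < N"
      using fin by (intro eventually_ball_finite) (auto intro: eventually_gt_at_top)
    thus "\<forall>\<^sub>F N in at_top. finite ({..<N} \<times> {..<N}) \<and> X \<subseteq> {..<N} \<times> {..<N} \<and>
            {..<N} \<times> {..<N} \<subseteq> (UNIV :: (nat \<times> nat) set)"
      by eventually_elim force
  qed
  moreover have "(sum f \<longlongrightarrow> infsum f UNIV) (finite_subsets_at_top UNIV)"
    using has_sum_infsum[OF assms] by (simp add: has_sum_def)
  ultimately have "(\<lambda>N. sum f ({..<N} \<times> {..<N})) \<longlonglongrightarrow> infsum f UNIV"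
    by (rule filterlim_compose[rotated])
  thus ?thesis
    by (simp add: sum.cartesian_product)
qed

text \<open>
  The sum of the terms over one far edge of the square: along the edge the series in \<open>n\<close>
  converges, and the weight \<open>N\<close> coming from \<open>G\<close> or \<open>H\<close> is beaten by \<open>(N + 1) powr (-1 - p)\<close>.
\<close>

lemma boundary_sum_tendsto_0:
  fixes f :: "nat \<Rightarrow> nat \<Rightarrow> complex" and p q K :: real
  assumes "p > 0" "q > 0"
    and "\<And>N n. norm (f N n) \<le> K * (real N * real (N + 1) powr (-1 - p) * real (n + 1) powr (-1 - q))"
  shows "(\<lambda>N. \<Sum>n<N. f N n) \<longlonglongrightarrow> 0"
proof (rule Lim_null_comparison)
  let ?g = "\<lambda>n. real (n + 1) powr (-1 - q)"
  have "(\<lambda>N. real N * real (N + 1) powr (-1 - p)) \<longlonglongrightarrow> 0"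
    using assms(1) by real_asymp
  from tendsto_mult_left[OF tendsto_mult_right[OF this], of "\<bar>K\<bar>" "suminf ?g"]
  show "(\<lambda>N. \<bar>K\<bar> * (real N * real (N + 1) powr (-1 - p) * suminf ?g)) \<longlonglongrightarrow> 0"
    by simp
  show "\<forall>\<^sub>F N in sequentially. norm (\<Sum>n<N. f N n) \<le>
          \<bar>K\<bar> * (real N * real (N + 1) powr (-1 - p) * suminf ?g)"
  proof (intro always_eventually allI)
    fix N
    have "norm (\<Sum>n<N. f N n) \<le> (\<Sum>n<N. norm (f N n))"
      by (rule norm_sum)
    also have "\<dots> \<le> (\<Sum>n<N. \<bar>K\<bar> * (real N * real (N + 1) powr (-1 - p) * ?g n))"
    proof (rule sum_mono)
      fix n
      have "K * (real N * real (N + 1) powr (-1 - p) * ?g n)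
              \<le> \<bar>K\<bar> * (real N * real (N + 1) powr (-1 - p) * ?g n)"
        by (intro mult_right_mono) auto
      with assms(3)[of N n]
      show "norm (f N n) \<le> \<bar>K\<bar> * (real N * real (N + 1) powr (-1 - p) * ?g n)"
        by linarith
    qed
    also have "\<dots> = \<bar>K\<bar> * (real N * real (N + 1) powr (-1 - p) * (\<Sum>n<N. ?g n))"
      by (simp add: sum_distrib_left)
    also have "\<dots> \<le> \<bar>K\<bar> * (real N * real (N + 1) powr (-1 - p) * suminf ?g)"
      using summable_Suc_powr[OF assms(2)]
      by (intro mult_left_mono sum_le_suminf) auto
    finally show "norm (\<Sum>n<N. f N n) \<le>
        \<bar>K\<bar> * (real N * real (N + 1) powr (-1 - p) * suminf ?g)" .
  qed
qed

definition dual_sum :: "complex \<Rightarrow> complex \<Rightarrow> complex \<Rightarrow> complex \<Rightarrow> complex \<Rightarrow> complex" where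
  "dual_sum a b c d e = infsum (dual_term a b c d e) UNIV"

text \<open>
  Summing the certificate over squares. Neither \<open>G\<close> nor \<open>H\<close> need be summable, as \<open>m t (m, 0)\<close>
  may decay as slowly as \<open>m powr (- Re s)\<close>; the limit is therefore taken on squares for both
  shifts together.
\<close>

lemma dual_sum_recurrence:
  fixes a b c d e :: complex
  defines "s \<equiv> d + e - a - b - c"
  assumes d: "d \<notin> \<int>\<^sub>\<le>\<^sub>0" and e: "e \<notin> \<int>\<^sub>\<le>\<^sub>0" and s: "Re s > 0" and ed: "Re (e - d) > 0"
  shows "e * (e - d) * s * dual_sum a b c d e =
           (e - a) * (e - b) * (e - c) * dual_sum a b c d (e + 1)"
proof -
  define t where "t = dual_term a b c d e"
  define t' where "t' = dual_term a b c d (e + 1)"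
  define k where "k = (e - a) * (e - b) * (e - c) / (e * s)"
  define G where "G = (\<lambda>m n. (d - e + of_nat n) / (s + of_nat n) * of_nat m * t (m, n))"
  define H where "H = (\<lambda>m n. - of_nat n * t (m, n))"
  have s': "s \<notin> \<int>\<^sub>\<le>\<^sub>0" using s by (rule Re_pos_notin_nonpos_Ints)
  have e1: "e + 1 \<notin> \<int>\<^sub>\<le>\<^sub>0"
    using add_of_nat_notin_nonpos_Ints[OF e, of 1] by simp
  have sum_t: "t summable_on UNIV"
    unfolding t_def using d e s ed
    by (intro abs_summable_summable[OF dual_term_abs_summable]) (auto simp: s_def)
  have sum_t': "t' summable_on UNIV"
    unfolding t'_def using d e1 s ed
    by (intro abs_summable_summable[OF dual_term_abs_summable]) (auto simp: s_def)

  obtain C where C: "C > 0" "\<And>m n. norm (t (m, n)) \<le>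
      C * (real (m + 1) powr (-1 - Re s) * real (n + 1) powr (-1 - Re (e - d)))"
    using norm_dual_term_le[of d e a b c] d e s' unfolding s_def t_def by metis
  \<comment> \<open>The rational factor of \<open>G\<close> is bounded because the denominator has real part at least
      \<open>Re s + n\<close>.\<close>
  define L where "L = norm (d - e) / Re s + 1"
  have L: "norm ((d - e + of_nat n) / (s + of_nat n)) \<le> L" for n
  proof -
    have "norm (d - e + of_nat n) \<le> norm (d - e) + real n"
      using norm_triangle_ineq[of "d - e" "of_nat n"] by simp
    also have "\<dots> \<le> L * (Re s + real n)"
      using s by (simp add: L_def field_simps)
    also have "\<dots> \<le> L * norm (s + of_nat n)"
      using complex_Re_le_cmod[of "s + of_nat n"] s by (intro mult_left_mono) (auto simp: L_def)
    finally show ?thesis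
      using add_of_nat_neq_0[OF s', of n] by (simp add: norm_divide divide_le_eq)
  qed
  have L0: "L \<ge> 0" using s by (simp add: L_def)
  have boundary1: "(\<lambda>N. \<Sum>n<N. G N n) \<longlonglongrightarrow> 0"
  proof (rule boundary_sum_tendsto_0[OF s ed, where K = "L * C"])
    fix N n
    have "norm (G N n) = norm ((d - e + of_nat n) / (s + of_nat n)) * real N * norm (t (N, n))"
      by (simp only: G_def norm_mult norm_of_nat)
    also have "\<dots> \<le> L * real N *
        (C * (real (N + 1) powr (-1 - Re s) * real (n + 1) powr (-1 - Re (e - d))))"
      using L0 by (intro mult_mono L C(2)) auto
    finally show "norm (G N n) \<le> L * C *
        (real N * real (N + 1) powr (-1 - Re s) * real (n + 1) powr (-1 - Re (e - d)))"
      by (simp add: mult_ac)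
  qed
  have boundary2: "(\<lambda>N. \<Sum>m<N. H m N) \<longlonglongrightarrow> 0"
  proof (rule boundary_sum_tendsto_0[OF ed s, where K = C])
    fix N m
    have "norm (H m N) = real N * norm (t (m, N))"
      by (simp add: H_def norm_mult)
    also have "\<dots> \<le> real N *
        (C * (real (m + 1) powr (-1 - Re s) * real (N + 1) powr (-1 - Re (e - d))))"
      by (intro mult_left_mono C(2)) auto
    finally show "norm (H m N) \<le> C *
        (real N * real (N + 1) powr (-1 - Re (e - d)) * real (m + 1) powr (-1 - Re s))"
      by (simp add: mult_ac)
  qed

  have cert: "(e - d) * t (m, n) - k * t' (m, n) =
      (G (Suc m) n - G m n) + (H m (Suc n) - H m n)" for m n
    unfolding t_def t'_def k_def G_def H_def s_def
    by (rule dual_term_certificate) (use d e s' in \<open>auto simp: s_def\<close>)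
  have "(\<Sum>m<N. \<Sum>n<N. (e - d) * t (m, n) - k * t' (m, n)) = (\<Sum>n<N. G N n) + (\<Sum>m<N. H m N)" for N
  proof -
    have G: "(\<Sum>m<N. G (Suc m) n - G m n) = G N n" for n
      using sum_lessThan_telescope[of "\<lambda>m. G m n" N] by (simp add: G_def)
    have H: "(\<Sum>n<N. H m (Suc n) - H m n) = H m N" for m
      using sum_lessThan_telescope[of "\<lambda>n. H m n" N] by (simp add: H_def)
    have "(\<Sum>m<N. \<Sum>n<N. (e - d) * t (m, n) - k * t' (m, n)) =
          (\<Sum>m<N. \<Sum>n<N. (G (Suc m) n - G m n) + (H m (Suc n) - H m n))"
      by (simp only: cert)
    also have "\<dots> = (\<Sum>n<N. \<Sum>m<N. G (Suc m) n - G m n) + (\<Sum>m<N. \<Sum>n<N. H m (Suc n) - H m n)"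
      by (simp only: sum.distrib) (subst sum.swap, rule refl)
    also have "\<dots> = (\<Sum>n<N. G N n) + (\<Sum>m<N. H m N)"
      by (simp only: G H)
    finally show ?thesis .
  qed
  hence "(\<lambda>N. \<Sum>m<N. \<Sum>n<N. (e - d) * t (m, n) - k * t' (m, n)) \<longlonglongrightarrow> 0"
    using tendsto_add[OF boundary1 boundary2] by simp
  moreover have "(\<lambda>N. \<Sum>m<N. \<Sum>n<N. (e - d) * t (m, n) - k * t' (m, n))
      \<longlonglongrightarrow> (e - d) * infsum t UNIV - k * infsum t' UNIV"
    using tendsto_diff[OF tendsto_mult_left[OF sum_squares_LIMSEQ_infsum[OF sum_t], of "e - d"]
        tendsto_mult_left[OF sum_squares_LIMSEQ_infsum[OF sum_t'], of k]]
    by (simp add: sum_subtractf sum_distrib_left)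
  ultimately have "(e - d) * infsum t UNIV = k * infsum t' UNIV"
    using LIMSEQ_unique by fastforce
  moreover have "e \<noteq> 0" "s \<noteq> 0" using e s' by auto
  ultimately show ?thesis
    unfolding dual_sum_def t_def [symmetric] t'_def [symmetric]
    by (simp add: k_def field_simps)
qed

lemma dual_sum_iterate:
  fixes a b c d e :: complex
  defines "s \<equiv> d + e - a - b - c"
  assumes d: "d \<notin> \<int>\<^sub>\<le>\<^sub>0" and e: "e \<notin> \<int>\<^sub>\<le>\<^sub>0" and s: "Re s > 0" and ed: "Re (e - d) > 0"
  shows "pochhammer e N * pochhammer (e - d) N * pochhammer s N * dual_sum a b c d e =
           pochhammer (e - a) N * pochhammer (e - b) N * pochhammer (e - c) N *
           dual_sum a b c d (e + of_nat N)"
proof (induction N)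
  case (Suc N)
  let ?e = "e + of_nat N"
  have e': "?e \<notin> \<int>\<^sub>\<le>\<^sub>0"
    using e by (rule add_of_nat_notin_nonpos_Ints)
  have rec: "?e * (?e - d) * (s + of_nat N) * dual_sum a b c d ?e =
        (?e - a) * (?e - b) * (?e - c) * dual_sum a b c d (?e + 1)"
    using dual_sum_recurrence[of d ?e a b c] d e' s ed by (simp add: s_def algebra_simps)
  let ?P = "pochhammer e N * pochhammer (e - d) N * pochhammer s N"
  let ?Q = "pochhammer (e - a) N * pochhammer (e - b) N * pochhammer (e - c) N"
  have "pochhammer e (Suc N) * pochhammer (e - d) (Suc N) * pochhammer s (Suc N) *
          dual_sum a b c d e =
        ?e * (?e - d) * (s + of_nat N) * (?P * dual_sum a b c d e)"
    by (simp add: pochhammer_Suc algebra_simps)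
  also have "\<dots> = ?Q * (?e * (?e - d) * (s + of_nat N) * dual_sum a b c d ?e)"
    unfolding Suc.IH by (simp only: mult_ac)
  also have "\<dots> = ?Q * (?e - a) * (?e - b) * (?e - c) * dual_sum a b c d (?e + 1)"
    unfolding rec by (simp only: mult_ac)
  also have "\<dots> = pochhammer (e - a) (Suc N) * pochhammer (e - b) (Suc N) *
      pochhammer (e - c) (Suc N) * dual_sum a b c d (e + of_nat (Suc N))"
    by (simp add: pochhammer_Suc algebra_simps)
  finally show ?case .
qed simp


section \<open>The limit\<close>

lemma norm_add_of_nat_mono:
  assumes "Re z > 0"
  shows "norm (z + of_nat k) \<le> norm (z + of_nat N + of_nat k)"
  unfolding cmod_def using assms by (simp add: power_mono)

lemma norm_pochhammer_shift_mono:
  assumes "Re z > 0"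
  shows "norm (pochhammer z m) \<le> norm (pochhammer (z + of_nat N) m)"
  using norm_add_of_nat_mono[OF assms]
  by (auto simp: pochhammer_prod norm_mult simp flip: prod_norm intro!: prod_mono)

lemma norm_pochhammer_quotient_le:
  assumes "Re z > 0"
  shows "norm (pochhammer z m / pochhammer (z + of_nat N) m) \<le>
           (if m = 0 then 1 else norm z / norm (z + of_nat N))"
proof (cases m)
  case (Suc k)
  have nz: "z + of_nat N \<noteq> 0" "pochhammer (z + of_nat N + 1) k \<noteq> 0"
    using assms Re_pos_notin_nonpos_Ints[of "z + of_nat N"]
      Re_pos_notin_nonpos_Ints[of "z + of_nat N + 1"]
    by (auto intro!: pochhammer_neq_0)
  have "norm (pochhammer (z + 1) k) \<le> norm (pochhammer (z + of_nat N + 1) k)"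
    using norm_pochhammer_shift_mono[of "z + 1" k N] assms by (simp add: add_ac)
  hence "norm (pochhammer (z + 1) k) / norm (pochhammer (z + of_nat N + 1) k) \<le> 1"
    by (simp add: divide_le_eq_1)
  hence "norm z / norm (z + of_nat N) *
           (norm (pochhammer (z + 1) k) / norm (pochhammer (z + of_nat N + 1) k)) \<le>
         norm z / norm (z + of_nat N) * 1"
    by (intro mult_left_mono) auto
  thus ?thesis
    using Suc by (simp add: pochhammer_rec norm_mult norm_divide)
qed simp

text \<open>
  Passing from \<open>e\<close> to \<open>e + N\<close> multiplies a term by the quotients \<open>(e)\<^sub>m / (e + N)\<^sub>m\<close> and
  \<open>(s)\<^sub>n / (s + N)\<^sub>n\<close>. Since \<open>e\<close> and \<open>s\<close> have positive real part, both have norm at most \<open>1\<close>,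
  and away from \<open>(0, 0)\<close> one of them is at most \<open>\<bar>e\<bar> / \<bar>e + N\<bar>\<close> or \<open>\<bar>s\<bar> / \<bar>s + N\<bar>\<close>. So all terms
  but the first shrink by a uniform factor tending to \<open>0\<close>.
\<close>

lemma dual_sum_LIMSEQ_if_Re_pos:
  fixes a b c d e :: complex
  defines "s \<equiv> d + e - a - b - c"
  assumes d: "d \<notin> \<int>\<^sub>\<le>\<^sub>0" and e: "Re e > 0" and s: "Re s > 0" and ed: "Re (e - d) > 0"
  shows "(\<lambda>N. dual_sum a b c d (e + of_nat N)) \<longlonglongrightarrow> 1"
proof -
  define t where "t = (\<lambda>N. dual_term a b c d (e + of_nat N))"
  define r where "r = (\<lambda>N. norm e / norm (e + of_nat N) + norm s / norm (s + of_nat N))"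
  let ?A = "UNIV - {(0, 0)} :: (nat \<times> nat) set"
  have summ: "(\<lambda>p. norm (t N p)) summable_on UNIV" for N
    unfolding t_def
    by (intro dual_term_abs_summable d Re_pos_notin_nonpos_Ints[of "e + of_nat N"])
       (use e s ed in \<open>auto simp: s_def\<close>)
  have tN: "norm (t N p) \<le> r N * norm (t 0 p)" if "p \<noteq> (0, 0)" for N p
  proof -
    obtain m n where p: "p = (m, n)" by force
    have nz: "pochhammer e m \<noteq> 0" "pochhammer s n \<noteq> 0"
      using e s by (auto intro!: pochhammer_neq_0 Re_pos_notin_nonpos_Ints)
    have s_shift: "d + (e + of_nat N) - a - b - c = s + of_nat N" by (simp add: s_def)
    have "t N p = t 0 p * ((pochhammer e m / pochhammer (e + of_nat N) m) *
             (pochhammer s n / pochhammer (s + of_nat N) n))"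
      using nz by (simp add: t_def p dual_term_eq s_shift mult_ac flip: s_def)
    hence "norm (t N p) = norm (pochhammer e m / pochhammer (e + of_nat N) m) *
             norm (pochhammer s n / pochhammer (s + of_nat N) n) * norm (t 0 p)"
      by (simp only: norm_mult mult_ac)
    also have "\<dots> \<le> r N * norm (t 0 p)"
    proof (rule mult_right_mono)
      have one: "norm z / norm (z + of_nat N) \<le> 1" if "Re z > 0" for z
        using norm_add_of_nat_mono[OF that, of 0 N] by (simp add: divide_le_eq_1)
      let ?be = "if m = 0 then 1 else norm e / norm (e + of_nat N)"
      let ?bs = "if n = 0 then 1 else norm s / norm (s + of_nat N)"
      have "norm (pochhammer e m / pochhammer (e + of_nat N) m) *
             norm (pochhammer s n / pochhammer (s + of_nat N) n) \<le> ?be * ?bs"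
        using norm_pochhammer_quotient_le[OF e, of m N] norm_pochhammer_quotient_le[OF s, of n N]
        by (intro mult_mono) auto
      also have "?be * ?bs \<le> r N"
      proof (cases "m = 0")
        case True
        thus ?thesis using that p by (simp add: r_def)
      next
        case False
        have "?be * ?bs \<le> ?be * 1"
          using one[OF s] by (intro mult_left_mono) auto
        thus ?thesis using False by (simp add: r_def add_increasing2)
      qed
      finally show "norm (pochhammer e m / pochhammer (e + of_nat N) m) *
             norm (pochhammer s n / pochhammer (s + of_nat N) n) \<le> r N" .
    qed simp
    finally show ?thesis .
  qed
  have summA: "(\<lambda>p. norm (t N p)) summable_on ?A" for N
    using summ by (rule summable_on_subset_banach) auto
  have bound: "norm (dual_sum a b c d (e + of_nat N) - 1) \<le> r N * infsum (\<lambda>p. norm (t 0 p)) ?A" for N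
  proof -
    have "dual_sum a b c d (e + of_nat N) = infsum (t N) (insert (0, 0) ?A)"
      by (simp add: dual_sum_def t_def insert_absorb)
    also have "\<dots> = t N (0, 0) + infsum (t N) ?A"
      by (rule infsum_insert) (use abs_summable_summable[OF summA] in auto)
    also have "t N (0, 0) = 1"
      by (simp add: t_def dual_term_eq)
    finally have "norm (dual_sum a b c d (e + of_nat N) - 1) = norm (infsum (t N) ?A)"
      by simp
    also have "\<dots> \<le> infsum (\<lambda>p. norm (t N p)) ?A"
      by (rule norm_infsum_bound[OF summA])
    also have "\<dots> \<le> infsum (\<lambda>p. r N * norm (t 0 p)) ?A"
      using tN by (intro infsum_mono summA summable_on_cmult_right) auto
    also have "\<dots> = r N * infsum (\<lambda>p. norm (t 0 p)) ?A"
      by (intro infsum_cmult_right summA)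
    finally show ?thesis .
  qed
  have lim: "(\<lambda>N. norm z / norm (z + of_nat N)) \<longlonglongrightarrow> 0" for z :: complex
  proof (rule tendsto_divide_0[OF tendsto_const])
    have "filterlim (\<lambda>N. norm (z + of_nat N)) at_top sequentially"
      by (intro filterlim_compose[OF filterlim_norm_at_top]
            tendsto_add_filterlim_at_infinity[OF tendsto_const] tendsto_of_nat)
    thus "filterlim (\<lambda>N. norm (z + of_nat N)) at_infinity sequentially"
      by (rule filterlim_at_top_imp_at_infinity)
  qed
  have "r \<longlonglongrightarrow> 0"
    unfolding r_def using tendsto_add[OF lim[of e] lim[of s]] by simp
  hence "(\<lambda>N. r N * infsum (\<lambda>p. norm (t 0 p)) ?A) \<longlonglongrightarrow> 0"
    by (rule tendsto_mult_left_zero)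
  hence "(\<lambda>N. dual_sum a b c d (e + of_nat N) - 1) \<longlonglongrightarrow> 0"
    by (rule Lim_null_comparison[OF always_eventually, rotated]) (use bound in auto)
  thus ?thesis by (simp add: LIM_zero_iff)
qed

lemma dual_sum_LIMSEQ:
  fixes a b c d e :: complex
  assumes d: "d \<notin> \<int>\<^sub>\<le>\<^sub>0" and s: "Re (d + e - a - b - c) > 0" and ed: "Re (e - d) > 0"
  shows "(\<lambda>N. dual_sum a b c d (e + of_nat N)) \<longlonglongrightarrow> 1"
proof -
  obtain k :: nat where k: "- Re e < real k"
    using reals_Archimedean2 by blast
  have "(\<lambda>N. dual_sum a b c d (e + of_nat k + of_nat N)) \<longlonglongrightarrow> 1"
    by (rule dual_sum_LIMSEQ_if_Re_pos) (use k d s ed in auto)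
  hence "(\<lambda>N. dual_sum a b c d (e + of_nat (N + k))) \<longlonglongrightarrow> 1"
    by (simp add: add_ac)
  thus ?thesis by (rule LIMSEQ_offset)
qed

text \<open>
  The numerator and denominator parameters of the iterated recurrence have equal sums,
  \<open>e + (e - d) + s = (e - a) + (e - b) + (e - c)\<close>, so the exponential factors in Euler's limit
  formula cancel.
\<close>

lemma dual_sum_eq:
  fixes a b c d e :: complex
  defines "s \<equiv> d + e - a - b - c"
  assumes d: "d \<notin> \<int>\<^sub>\<le>\<^sub>0" and e: "e \<notin> \<int>\<^sub>\<le>\<^sub>0" and s: "Re s > 0" and ed: "Re (e - d) > 0"
  shows "dual_sum a b c d e =
           Gamma e * Gamma s * Gamma (e - d) * (rGamma (e - a) * rGamma (e - b) * rGamma (e - c))"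
proof -
  let ?P = "\<lambda>N. rGamma_series e N * rGamma_series (e - d) N * rGamma_series s N"
  let ?Q = "\<lambda>N. rGamma_series (e - a) N * rGamma_series (e - b) N * rGamma_series (e - c) N"
  have eq: "?P N * dual_sum a b c d e = ?Q N * dual_sum a b c d (e + of_nat (Suc N))"
    if "N > 0" for N
  proof -
    define l :: complex where "l = of_real (ln (of_nat N))"
    have exps: "exp (e * l) * exp ((e - d) * l) * exp (s * l) =
           exp ((e - a) * l) * exp ((e - b) * l) * exp ((e - c) * l)"
      by (simp add: s_def algebra_simps flip: exp_add)
    define E where "E = fact N ^ 3 * (exp (e * l) * exp ((e - d) * l) * exp (s * l))"
    have E': "E = fact N ^ 3 * (exp ((e - a) * l) * exp ((e - b) * l) * exp ((e - c) * l))"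
      by (simp only: E_def exps)
    have P: "pochhammer e (Suc N) * pochhammer (e - d) (Suc N) * pochhammer s (Suc N) = ?P N * E"
      unfolding E_def l_def
      by (simp add: rGamma_series_def power3_eq_cube)
    have Q: "pochhammer (e - a) (Suc N) * pochhammer (e - b) (Suc N) * pochhammer (e - c) (Suc N) =
             ?Q N * E"
      unfolding E' l_def
      by (simp add: rGamma_series_def power3_eq_cube)
    have "?P N * E * dual_sum a b c d e = ?Q N * E * dual_sum a b c d (e + of_nat (Suc N))"
      using dual_sum_iterate[of d e a b c "Suc N"] d e s ed unfolding s_def[symmetric] P Q by simp
    moreover have "E \<noteq> 0" by (simp add: E_def)
    ultimately show ?thesis by (simp add: mult_ac)
  qed
  have "(\<lambda>N. ?Q N * dual_sum a b c d (e + of_nat (Suc N))) \<longlonglongrightarrow>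
          rGamma (e - a) * rGamma (e - b) * rGamma (e - c) * 1"
    using d s ed
    by (intro tendsto_mult rGamma_series_LIMSEQ
          filterlim_compose[OF dual_sum_LIMSEQ filterlim_Suc]) (auto simp: s_def)
  moreover have "\<forall>\<^sub>F N in sequentially.
      ?Q N * dual_sum a b c d (e + of_nat (Suc N)) = ?P N * dual_sum a b c d e"
    using eventually_gt_at_top[of 0] by eventually_elim (use eq in simp)
  ultimately have "(\<lambda>N. ?P N * dual_sum a b c d e) \<longlonglongrightarrow>
      rGamma (e - a) * rGamma (e - b) * rGamma (e - c)"
    by (simp add: filterlim_cong)
  moreover have "(\<lambda>N. ?P N * dual_sum a b c d e) \<longlonglongrightarrow>
      rGamma e * rGamma (e - d) * rGamma s * dual_sum a b c d e"
    by (intro tendsto_mult rGamma_series_LIMSEQ tendsto_const)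
  ultimately have "rGamma e * rGamma (e - d) * rGamma s * dual_sum a b c d e =
      rGamma (e - a) * rGamma (e - b) * rGamma (e - c)"
    using LIMSEQ_unique by blast
  moreover have "Gamma e \<noteq> 0" "Gamma (e - d) \<noteq> 0" "Gamma s \<noteq> 0"
    using e s ed by (auto simp: Gamma_eq_zero_iff Re_pos_notin_nonpos_Ints)
  ultimately show ?thesis
    by (simp add: rGamma_inverse_Gamma field_simps)
qed

theorem mainTheorem4:
  fixes a b c d e :: complex
  assumes "Re (e - d) > 0"
    and "Re (d + e - a - b - c) > 0"
    and "d \<notin> \<int>\<^sub>\<le>\<^sub>0"
    and "e \<notin> \<int>\<^sub>\<le>\<^sub>0"
    and "d + e - a - b - c \<notin> \<int>\<^sub>\<le>\<^sub>0"
  shows "(\<lambda>p. norm (kampe_term d a b c e (d - a) (d - b) (d - c) (d + e - a - b - c) 1 1 p))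
           summable_on UNIV \<and>
         kampe_F d a b c e (d - a) (d - b) (d - c) (d + e - a - b - c) 1 1 =
           Gamma e * Gamma (e + d - a - b - c) * Gamma (e - d) *
           (rGamma (e - a) * rGamma (e - b) * rGamma (e - c))"
proof
  note summ = dual_term_abs_summable[OF assms(3,4,2,1)]
  show "(\<lambda>p. norm (kampe_term d a b c e (d - a) (d - b) (d - c) (d + e - a - b - c) 1 1 p))
          summable_on UNIV"
    using summ by (simp add: dual_term_def)
  have "kampe_F d a b c e (d - a) (d - b) (d - c) (d + e - a - b - c) 1 1 = dual_sum a b c d e"
    by (simp add: kampe_F_def dual_sum_def dual_term_def)
  also have "\<dots> = Gamma e * Gamma (d + e - a - b - c) * Gamma (e - d) *
      (rGamma (e - a) * rGamma (e - b) * rGamma (e - c))"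
    by (rule dual_sum_eq[OF assms(3,4,2,1)])
  finally show "kampe_F d a b c e (d - a) (d - b) (d - c) (d + e - a - b - c) 1 1 =
           Gamma e * Gamma (e + d - a - b - c) * Gamma (e - d) *
           (rGamma (e - a) * rGamma (e - b) * rGamma (e - c))"
    by (simp add: add.commute)
qed

end
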